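(* Every commutative-rectangular band is a stabilized semigroup with respect to $\{\mathcal{LI},\mathcal{RI}\}$, and also a stabilized semigroup with respect to $\{\mathcal{LZ},\mathcal{RZ}\}$.
   Context: A band is a semigroup in which every element is idempotent. A commutative-rectangular band is a band $S$ such that for any $a,b\in S$, either $ab=ba$, or $a$ and $b$ are generalized inverses of each other, i.e. $aba=a$ and $bab=b$. For a set $S$ with a binary operation (written by juxtaposition) and $a\in S$, define $\mathcal{LI}(a)=\{b\in S \mid ba=a\}$, $\mathcal{RI}(a)=\{b\in S\mid ab=a\}$, $\mathcal{LZ}(a)=\{b\in S\mid ba=b\}$ and $\mathcal{RZ}(a)=\{b\in S\mid ab=b\}$. Each is viewed as a binary relation on $S$ (e.g. $a\,\mathcal{LI}\,b$ iff $b\in\mathcal{LI}(a)$). A semigroup $(S,\star)$ is a stabilized semigroup with respect to a family of such relations if, for every semigroup $(S,\star')$ on the same underlying set such that for each $\rho$ in the family and each $a\in S$ the set $\rho(a)$ computed with $\star$ equals the set $\rho(a)$ computed with $\star'$, one has $\star=\star'$. *)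

theory Defs
  imports Main
begin

locale band = semigroup +
  assumes idem: "a \<^bold>* a = a"

locale commutative_rectangular_band = band +
  assumes commutative_rectangular:
    "a \<^bold>* b = b \<^bold>* a \<or> (a \<^bold>* b \<^bold>* a = a \<and> b \<^bold>* a \<^bold>* b = b)"

text \<open>
  The relations are parameterized by the operation, so that they can be computed for two different
  operations on the same underlying set (here: the universe of the type).
\<close>

definition LI :: "('a \<Rightarrow> 'a \<Rightarrow> 'a) \<Rightarrow> 'a \<Rightarrow> 'a set" where
  "LI f a = {b. f b a = a}"

definition RI :: "('a \<Rightarrow> 'a \<Rightarrow> 'a) \<Rightarrow> 'a \<Rightarrow> 'a set" where
  "RI f a = {b. f a b = a}"

definition LZ :: "('a \<Rightarrow> 'a \<Rightarrow> 'a) \<Rightarrow> 'a \<Rightarrow> 'a set" where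
  "LZ f a = {b. f b a = b}"

definition RZ :: "('a \<Rightarrow> 'a \<Rightarrow> 'a) \<Rightarrow> 'a \<Rightarrow> 'a set" where
  "RZ f a = {b. f a b = b}"

text \<open>The competing operation \<open>g\<close> ranges over all semigroups, not only over bands.\<close>

definition stabilized_semigroup ::
  "(('a \<Rightarrow> 'a \<Rightarrow> 'a) \<Rightarrow> 'a \<Rightarrow> 'a set) set \<Rightarrow> ('a \<Rightarrow> 'a \<Rightarrow> 'a) \<Rightarrow> bool" where
  "stabilized_semigroup R f \<longleftrightarrow> semigroup f \<and>
     (\<forall>g. semigroup g \<longrightarrow> (\<forall>\<rho>\<in>R. \<forall>a. \<rho> f a = \<rho> g a) \<longrightarrow> f = g)"

end

theory Submission
  imports Defs
begin

text \<open>
  \<open>LZ\<close> and \<open>RZ\<close> are the converses of \<open>RI\<close> and \<open>LI\<close>, so both families carry the same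
  information: Green's preorders \<open>\<le>\<^sub>R\<close> (\<open>b a = a\<close>) and \<open>\<le>\<^sub>L\<close> (\<open>a b = a\<close>). If \<open>a\<close> and \<open>b\<close>
  commute, then \<open>a b\<close> is their meet in the natural order, and comparing it with the other product
  \<open>c\<close> through the dichotomy for the pairs \<open>a, c\<close> and \<open>b, c\<close> forces equality. If they are mutually
  inverse, then both products lie in the \<open>H\<close>-class \<open>R\<^sub>a \<inter> L\<^sub>b\<close>, which is trivial in a band.
\<close>

lemma commutative_rectangular_band_determined_by_LI_RI:
  assumes "commutative_rectangular_band f" and "semigroup g"
    and R: "\<And>a b. f b a = a \<longleftrightarrow> g b a = a"
    and L: "\<And>a b. f a b = a \<longleftrightarrow> g a b = a"
  shows "f a b = g a b"
proof -
  interpret f: commutative_rectangular_band f by fact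
  interpret g: semigroup g by fact
  have g_idem: "g x x = x" for x
    using R[of x x] by (simp add: f.idem)
  have f_left_idem: "f x (f x y) = f x y" for x y
    using f.assoc[of x x y] by (simp add: f.idem)
  have f_right_idem: "f (f x y) y = f x y" for x y
    by (simp add: f.assoc f.idem)
  define c where "c = g a b"
  define d where "d = f a b"
  have gad: "g a d = d" and gdb: "g d b = d"
    using R[of a d] L[of d b] f_left_idem f_right_idem by (auto simp: d_def)
  consider (comm) "f a b = f b a" | (rect) "f (f a b) a = a" "f (f b a) b = b"
    using f.commutative_rectangular by blast
  then have "c = d"
  proof cases
    case comm
    have ac: "f a c = c" and cb: "f c b = c"
      using R[of a c] L[of c b] g.assoc[of a a b] g.assoc[of a b b] by (auto simp: c_def g_idem)
    have "f b d = d" "f d a = d"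
      using comm f_left_idem f_right_idem by (auto simp: d_def)
    then have "g b d = d" "g d a = d"
      using R[of b d] L[of d a] by auto
    \<comment> \<open>Under \<open>g\<close>, both factors of \<open>c\<close> fix \<open>d\<close>
      on either side, hence so does \<open>c\<close>.\<close>
    then have "g c d = d" "g d c = d"
      using gad gdb g.assoc[of a b d] g.assoc[of d a b] by (auto simp: c_def)
    then have "f c d = d" "f d c = d"
      using R[of c d] L[of d c] by auto
    then have ca: "f c a = d" and bc: "f b c = d"
      using ac cb comm f.assoc[of c b a] f.assoc[of b a c] by (auto simp: d_def)
    \<comment> \<open>Commuting gives \<open>c = f a c = f c a = d\<close>; mutual inverses give
      \<open>a = f (f a c) a = f c a = d\<close>.\<close>
    have "c = d \<or> a = d"
      using f.commutative_rectangular[of a c] ac ca by auto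
    moreover have "c = d \<or> b = d"
      using f.commutative_rectangular[of b c] bc cb by (auto simp: f.assoc)
    \<comment> \<open>Otherwise \<open>a = d = b\<close>, and then
      \<open>c = g a a = a = d\<close>.\<close>
    ultimately show ?thesis
      using g_idem c_def by auto
  next
    case rect
    \<comment> \<open>The reversed product witnesses \<open>a = g c e\<close>, so
      \<open>d = g a d\<close> lies in the right ideal of the idempotent \<open>c\<close>, which
      therefore fixes \<open>d\<close> on the left.\<close>
    define e where "e = f b a"
    have "f d a = a" "f b d = b" "f a e = a" "f b e = e"
      using rect f_left_idem by (auto simp: d_def e_def f.assoc)
    then have "g d a = a" "g b d = b" "g a e = a" "g b e = e"
      using R[of d a] L[of b d] L[of a e] R[of b e] by auto
    then have "g c e = a" "g c d = c"
      using g.assoc[of a b e] g.assoc[of a b d] by (auto simp: c_def)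
    then have "d = g c (g e d)"
      using gad g.assoc[of c e d] by simp
    then have "g c d = d"
      using g.assoc[of c c "g e d"] by (simp add: g_idem)
    with \<open>g c d = c\<close> show ?thesis by simp
  qed
  then show ?thesis by (simp add: c_def d_def)
qed

theorem theorem9p3:
  fixes f :: "'a \<Rightarrow> 'a \<Rightarrow> 'a"
  assumes "commutative_rectangular_band f"
  shows "stabilized_semigroup {LI, RI} f \<and> stabilized_semigroup {LZ, RZ} f"
proof -
  interpret f: commutative_rectangular_band f by fact
  have "f = g" if "semigroup g" and *: "\<forall>\<rho>\<in>{LI, RI}. \<forall>a. \<rho> f a = \<rho> g a" for g
  proof (intro ext commutative_rectangular_band_determined_by_LI_RI[OF assms that(1)])
    fix a b
    from * have "LI f a = LI g a" "RI f a = RI g a" by auto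
    then show "f b a = a \<longleftrightarrow> g b a = a" "f a b = a \<longleftrightarrow> g a b = a"
      unfolding LI_def RI_def by blast+
  qed
  moreover have "f = g" if "semigroup g" and *: "\<forall>\<rho>\<in>{LZ, RZ}. \<forall>a. \<rho> f a = \<rho> g a" for g
  proof (intro ext commutative_rectangular_band_determined_by_LI_RI[OF assms that(1)])
    fix a b
    from * have "LZ f b = LZ g b" "RZ f b = RZ g b" by auto
    then show "f b a = a \<longleftrightarrow> g b a = a" "f a b = a \<longleftrightarrow> g a b = a"
      unfolding LZ_def RZ_def by blast+
  qed
  ultimately show ?thesis
    unfolding stabilized_semigroup_def using f.semigroup_axioms by blast
qed

end
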